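(* Let $(T_i,X_i,Y_i)$, $i=1,2,\ldots$, be i.i.d. copies of $(T,X,Y)$ with $Y=TY(1)+(1-T)Y(0)$. Assume: (i) $Y(t)$ is conditionally independent of $T$ given $X$, for $t=0,1$; (ii) there is $\eta>0$ with $\eta<e(X)<1-\eta$ almost surely, where $e(X)=P(T=1\mid X)$; (iii) $\hat\beta^*\stackrel{p}{\longrightarrow}\beta^*$ as $n\to\infty$; (iv) there is $\nu>0$ with $\nu<e^*(X)<1-\nu$ almost surely, where $e^*(X)=e^{\mathrm{mis}}(X,\beta^* )$; (v) $\hat\alpha^*_t\stackrel{p}{\longrightarrow}\alpha^*_t$ as $n\to\infty$, $t=0,1$; (vi) the weak law of large numbers with estimated parameters holds for the summands of the estimator, in the sense specified in the context. Let $$\hat\Delta^*_{\mathrm{DR}}=\frac1n\sum_{i=1}^n\frac{T_iY_i-(T_i-\hat e^*(X_i))\hat\mu^*_1(X_i)}{\hat e^*(X_i)}-\frac1n\sum_{i=1}^n\frac{(1-T_i)Y_i+(T_i-\hat e^*(X_i))\hat\mu^*_0(X_i)}{1-\hat e^*(X_i)},$$ where $\hat e^*(X_i)=e^{\mathrm{mis}}(X_i,\hat\beta^* )$ and $\hat\mu^*_t(X_i)=\mu^{\mathrm{mis}}_t(X_i,\hat\alpha^*_t)$, $t=0,1$. Then, as $n\to\infty$, $$\hat\Delta^*_{\mathrm{DR}}-\Delta\stackrel{p}{\longrightarrow}E\left[\frac{(e(X)-e^*(X))(\mu_1(X)-\mu^*_1(X))}{e^*(X)}\right]+E\left[\fr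ac{(e(X)-e^*(X))(\mu_0(X)-\mu^*_0(X))}{1-e^*(X)}\right].$$
   Context: $X$ is a random vector of covariates, $T\in\{0,1\}$ a binary treatment, and $Y(1),Y(0)$ are integrable real-valued potential outcomes. Notation: $\mu_t=E[Y(t)]$, $\mu_t(X)=E(Y(t)\mid X)$, $t=0,1$, and $\Delta=\mu_1-\mu_0$ (the average causal effect). $e^{\mathrm{mis}}(x,\beta)$ is a parametric working model (with values in $(0,1)$) for the propensity score $e(X)$, and $\mu^{\mathrm{mis}}_t(x,\alpha_t)$, $t=0,1$, are parametric working models for $\mu_t(X)$; none of them needs to be correctly specified. $\hat\beta^*$, $\hat\alpha^*_0$, $\hat\alpha^*_1$ are estimators computed from $(T_i,X_i,Y_i)_{i\le n}$, and $\beta^*,\alpha^*_0,\alpha^*_1$ are fixed parameter values. Write $e^*(X)=e^{\mathrm{mis}}(X,\beta^* )$ and $\mu^*_t(X)=\mu^{\mathrm{mis}}_t(X,\alpha^*_t)$, with $\mu^*_t(X)$ integrable, $t=0,1$. Regularity assumption (vi) (weak law of large numbers with estimated parameters): with $\theta=(\beta,\alpha_1,\alpha_0)$, $\hat\theta=(\hat\beta^*,\hat\alpha^*_1,\hat\alpha^*_0)$, $\theta_0=(\beta^*,\alpha^*_1,\alpha^*_0)$, for each of the functions $$g(T,X,Y,\theta)=\frac{TY-(T-e^{\mathrm{mis}}(X,\beta))\mu^{\mathrm{mis}}_1(X,\alpha_1)}{e^{\mathrm{mis}}(X,\beta)},\qquad g(T,X,Y,\theta)=\frac{(1-T)Y+(T-e^{\mathrm{mis}}(X,\beta))\mu^{\mathrm{mis}}_0(X,\alpha_0)}{1-e^{\mathrm{mis}}(X,\beta)}$$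 one has $\frac1n\sum_{i=1}^n g(T_i,X_i,Y_i,\hat\theta)\stackrel{p}{\longrightarrow}E[g(T,X,Y,\theta_0)]$. *)

theory Defs
  imports "HOL-Probability.Probability"
begin

definition sigma_gen :: "'a measure \<Rightarrow> ('a \<Rightarrow> 'x::topological_space) \<Rightarrow> 'a measure" where
  "sigma_gen M X = vimage_algebra (space M) X borel"

text \<open>Versions of \<open>E(Z | X)\<close> and \<open>P(A | X)\<close>, as random variables on \<open>M\<close>.\<close>

definition cond_mean :: "'a measure \<Rightarrow> ('a \<Rightarrow> 'x::topological_space) \<Rightarrow> ('a \<Rightarrow> real) \<Rightarrow> 'a \<Rightarrow> real" where
  "cond_mean M X Z = real_cond_exp M (sigma_gen M X) Z"

definition cond_probability :: "'a measure \<Rightarrow> ('a \<Rightarrow> 'x::topological_space) \<Rightarrow> 'a set \<Rightarrow> 'a \<Rightarrow> real" where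
  "cond_probability M X A = cond_mean M X (indicator A)"

definition propensity :: "'a measure \<Rightarrow> ('a \<Rightarrow> 'x::topological_space) \<Rightarrow> ('a \<Rightarrow> real) \<Rightarrow> 'a \<Rightarrow> real" where
  "propensity M X T = cond_probability M X {\<omega> \<in> space M. T \<omega> = 1}"

definition cond_indep_given ::
  "'a measure \<Rightarrow> ('a \<Rightarrow> 'x::topological_space) \<Rightarrow> ('a \<Rightarrow> real) \<Rightarrow> ('a \<Rightarrow> real) \<Rightarrow> bool" where
  "cond_indep_given M X U V \<longleftrightarrow>
     (\<forall>A \<in> sets borel. \<forall>B \<in> sets borel. AE \<omega> in M.
        cond_probability M X {\<omega>' \<in> space M. U \<omega>' \<in> A \<and> V \<omega>' \<in> B} \<omega>
          = cond_probability M X {\<omega>' \<in> space M. U \<omega>' \<in> A} \<omega>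
            * cond_probability M X {\<omega>' \<in> space M. V \<omega>' \<in> B} \<omega>)"

text \<open>Convergence in probability to a constant. Measurability of the sequence is part of the
  definition, because \<^const>\<open>measure\<close> is \<open>0\<close> on non-measurable sets.\<close>

definition conv_in_prob :: "'a measure \<Rightarrow> (nat \<Rightarrow> 'a \<Rightarrow> 'b::metric_space) \<Rightarrow> 'b \<Rightarrow> bool" where
  "conv_in_prob M Z c \<longleftrightarrow>
     (\<forall>n. Z n \<in> borel_measurable M) \<and>
     (\<forall>\<epsilon>>0. (\<lambda>n. measure M {\<omega> \<in> space M. dist (Z n \<omega>) c > \<epsilon>}) \<longlonglongrightarrow> 0)"

definition iid_copies ::
  "'a measure \<Rightarrow> (nat \<Rightarrow> 'a \<Rightarrow> 'z::topological_space) \<Rightarrow> ('a \<Rightarrow> 'z) \<Rightarrow> bool" where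
  "iid_copies M Zs Z \<longleftrightarrow>
     prob_space.indep_vars M (\<lambda>_. borel) Zs {1..} \<and>
     (\<forall>i\<ge>1. distr M borel (Zs i) = distr M borel Z)"

definition sample :: "(nat \<Rightarrow> 'a \<Rightarrow> real) \<Rightarrow> (nat \<Rightarrow> 'a \<Rightarrow> 'x) \<Rightarrow> (nat \<Rightarrow> 'a \<Rightarrow> real) \<Rightarrow>
    nat \<Rightarrow> 'a \<Rightarrow> (nat \<Rightarrow> real \<times> 'x \<times> real)" where
  "sample Ts Xs Ys n \<omega> = (\<lambda>i\<in>{1..n}. (Ts i \<omega>, Xs i \<omega>, Ys i \<omega>))"

text \<open>A sequence of estimators with values in the parameter set \<open>\<Theta>\<close>: the \<open>n\<close>-th one is a
  measurable function of the first \<open>n\<close> observations.\<close>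

definition estimator_seq ::
  "'p::topological_space set \<Rightarrow> (nat \<Rightarrow> (nat \<Rightarrow> real \<times> 'x::topological_space \<times> real) \<Rightarrow> 'p) \<Rightarrow> bool" where
  "estimator_seq \<Theta> est \<longleftrightarrow>
     (\<forall>n. est n \<in> PiM {1..n} (\<lambda>_. borel) \<rightarrow>\<^sub>M restrict_space borel \<Theta>)"

definition dr_term1 ::
  "('x \<Rightarrow> 'b \<Rightarrow> real) \<Rightarrow> ('x \<Rightarrow> 'c \<Rightarrow> real) \<Rightarrow> real \<Rightarrow> 'x \<Rightarrow> real \<Rightarrow> 'b \<Rightarrow> 'c \<Rightarrow> real" where
  "dr_term1 e m1 t x y \<beta> \<alpha>1 = (t * y - (t - e x \<beta>) * m1 x \<alpha>1) / e x \<beta>"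

definition dr_term0 ::
  "('x \<Rightarrow> 'b \<Rightarrow> real) \<Rightarrow> ('x \<Rightarrow> 'd \<Rightarrow> real) \<Rightarrow> real \<Rightarrow> 'x \<Rightarrow> real \<Rightarrow> 'b \<Rightarrow> 'd \<Rightarrow> real" where
  "dr_term0 e m0 t x y \<beta> \<alpha>0 = ((1 - t) * y + (t - e x \<beta>) * m0 x \<alpha>0) / (1 - e x \<beta>)"

definition dr_estimator ::
  "('x \<Rightarrow> 'b \<Rightarrow> real) \<Rightarrow> ('x \<Rightarrow> 'c \<Rightarrow> real) \<Rightarrow> ('x \<Rightarrow> 'd \<Rightarrow> real) \<Rightarrow>
   (nat \<Rightarrow> 'a \<Rightarrow> real) \<Rightarrow> (nat \<Rightarrow> 'a \<Rightarrow> 'x) \<Rightarrow> (nat \<Rightarrow> 'a \<Rightarrow> real) \<Rightarrow>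
   (nat \<Rightarrow> 'a \<Rightarrow> 'b) \<Rightarrow> (nat \<Rightarrow> 'a \<Rightarrow> 'c) \<Rightarrow> (nat \<Rightarrow> 'a \<Rightarrow> 'd) \<Rightarrow> nat \<Rightarrow> 'a \<Rightarrow> real" where
  "dr_estimator e m1 m0 Ts Xs Ys \<beta>h \<alpha>1h \<alpha>0h n \<omega> =
     1 / real n * (\<Sum>i=1..n. dr_term1 e m1 (Ts i \<omega>) (Xs i \<omega>) (Ys i \<omega>) (\<beta>h n \<omega>) (\<alpha>1h n \<omega>))
   - 1 / real n * (\<Sum>i=1..n. dr_term0 e m0 (Ts i \<omega>) (Xs i \<omega>) (Ys i \<omega>) (\<beta>h n \<omega>) (\<alpha>0h n \<omega>))"

end

theory Submission
  imports Defs
begin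

text \<open>By (vi) the two averages converge to the means of the summands at the limiting parameters, so
  only these means matter. Conditional independence gives \<open>E(T Y(t) | X) = e(X) \<mu>\<^sub>t(X)\<close>, and since
  \<open>T Y = T Y(1)\<close> and \<open>(1 - T) Y = (1 - T) Y(0)\<close>, conditioning on \<open>X\<close> turns the mean of the first
  summand into \<open>E[e \<mu>\<^sub>1 / e\<^sup>* - (e - e\<^sup>*) \<mu>\<^sub>1\<^sup>* / e\<^sup>*] = E Y(1) + E[(e - e\<^sup>*) (\<mu>\<^sub>1 - \<mu>\<^sub>1\<^sup>*) / e\<^sup>*]\<close>, and similarly
  for the second.\<close>

section \<open>Conditional means given a random variable and their weighted integrals\<close>

lemma subalgebra_sigma_gen:
  assumes "X \<in> borel_measurable M"
  shows "subalgebra M (sigma_gen M X)"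
  using measurable_sets[OF assms] by (auto simp: subalgebra_def sigma_gen_def sets_vimage_algebra2)

lemma measurable_sigma_gen_comp:
  assumes "f \<in> borel_measurable borel"
  shows "(\<lambda>\<omega>. f (X \<omega>)) \<in> borel_measurable (sigma_gen M X)"
  unfolding sigma_gen_def by (rule measurable_compose[OF measurable_vimage_algebra1 assms]) simp

lemma (in prob_space) finite_measure_subalgebra_sigma_gen:
  assumes "X \<in> borel_measurable M"
  shows "finite_measure_subalgebra M (sigma_gen M X)"
  by unfold_locales (rule subalgebra_sigma_gen[OF assms])

text \<open>The last hypothesis says that \<open>E(D | U) = 0\<close>.\<close>

lemma (in prob_space) integral_mult_eq_0_of_set_integrals:
  fixes U D :: "'a \<Rightarrow> real"
  assumes U: "U \<in> borel_measurable M" and D: "integrable M D"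
    and UD: "integrable M (\<lambda>\<omega>. U \<omega> * D \<omega>)"
    and zero: "\<And>A. A \<in> sets borel \<Longrightarrow> (\<integral>\<omega>. indicator {\<omega> \<in> space M. U \<omega> \<in> A} \<omega> * D \<omega> \<partial>M) = 0"
  shows "(\<integral>\<omega>. U \<omega> * D \<omega> \<partial>M) = 0"
proof -
  interpret G: finite_measure_subalgebra M "sigma_gen M U"
    by (rule finite_measure_subalgebra_sigma_gen[OF U])
  \<comment> \<open>Conditioning is on \<open>U\<close> itself. The sets of
    \<open>sigma_gen M U\<close> are exactly the preimages of Borel sets under \<open>U\<close>, so
    \<open>zero\<close> covers all sets needed to characterise the conditional expectation.\<close>
  have "AE \<omega> in M. real_cond_exp M (sigma_gen M U) D \<omega> = 0"
  proof (rule G.real_cond_exp_charact)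
    fix C assume "C \<in> sets (sigma_gen M U)"
    then obtain A where A: "A \<in> sets borel" and "C = U -` A \<inter> space M"
      unfolding sigma_gen_def by (subst (asm) sets_vimage_algebra2) auto
    then have C: "C = {\<omega> \<in> space M. U \<omega> \<in> A}" by auto
    show "(\<integral>\<omega>\<in>C. D \<omega> \<partial>M) = (\<integral>\<omega>\<in>C. 0 \<partial>M)"
      using zero[OF A] by (simp add: C set_lebesgue_integral_def)
  qed (use D in auto)
  \<comment> \<open>\<open>U\<close> can be pulled out of the conditional expectation; integrability
    of the product is enough for this, so \<open>U\<close> may be unbounded.\<close>
  moreover have "U \<in> borel_measurable (sigma_gen M U)"
    using measurable_sigma_gen_comp[of "\<lambda>x. x" U M] by simp
  then have "(\<integral>\<omega>. U \<omega> * D \<omega> \<partial>M) = (\<integral>\<omega>. U \<omega> * real_cond_exp M (sigma_gen M U) D \<omega> \<partial>M)"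
    using G.real_cond_exp_intg(2)[OF UD] D by simp
  ultimately show ?thesis
    by (auto intro!: integral_eq_zero_AE elim!: eventually_mono)
qed

text \<open>Outcomes are merely integrable, so their products are controlled by keeping the other
  factor almost surely bounded: \<open>\<bar>K * f\<bar>\<close> dominates.\<close>

lemma integrable_mult_bounded_AE:
  fixes f g :: "'a \<Rightarrow> real"
  assumes "integrable M f" "g \<in> borel_measurable M" "AE \<omega> in M. \<bar>g \<omega>\<bar> \<le> K"
  shows "integrable M (\<lambda>\<omega>. g \<omega> * f \<omega>)"
proof (rule Bochner_Integration.integrable_bound)
  show "integrable M (\<lambda>\<omega>. K * f \<omega>)" using assms(1) by simp
  show "AE \<omega> in M. norm (g \<omega> * f \<omega>) \<le> norm (K * f \<omega>)"
    using assms(3)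
  proof eventually_elim
    case (elim \<omega>)
    then have "\<bar>g \<omega>\<bar> * \<bar>f \<omega>\<bar> \<le> \<bar>K\<bar> * \<bar>f \<omega>\<bar>" by (intro mult_right_mono) auto
    then show ?case by (simp add: abs_mult)
  qed
qed (use assms in auto)

lemma AE_abs_mult_le:
  fixes f g :: "'a \<Rightarrow> real"
  assumes "AE \<omega> in M. \<bar>f \<omega>\<bar> \<le> K" "AE \<omega> in M. \<bar>g \<omega>\<bar> \<le> 1"
  shows "AE \<omega> in M. \<bar>f \<omega> * g \<omega>\<bar> \<le> K"
  using assms
proof eventually_elim
  case (elim \<omega>)
  then show ?case using mult_mono[of "\<bar>f \<omega>\<bar>" K "\<bar>g \<omega>\<bar>" 1] by (simp add: abs_mult)
qed

text \<open>Conditional expectation is monotone, so the bounds 0 and 1 of the indicator pass to its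
  conditional expectation almost surely.\<close>

lemma (in prob_space) AE_abs_propensity_le_1:
  assumes "X \<in> borel_measurable M" and [measurable]: "T \<in> borel_measurable M"
  shows "AE \<omega> in M. \<bar>propensity M X T \<omega>\<bar> \<le> 1"
proof -
  interpret G: finite_measure_subalgebra M "sigma_gen M X"
    by (rule finite_measure_subalgebra_sigma_gen[OF assms(1)])
  have int: "integrable M (indicator {\<omega> \<in> space M. T \<omega> = 1} :: 'a \<Rightarrow> real)"
    by (simp add: integrable_indicator_iff emeasure_eq_measure)
  have "AE \<omega> in M. propensity M X T \<omega> \<ge> 0" "AE \<omega> in M. propensity M X T \<omega> \<le> 1"
    unfolding propensity_def cond_probability_def cond_mean_def
    by (intro G.real_cond_exp_ge_c G.real_cond_exp_le_c int AE_I2; simp add: indicator_def)+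
  then show ?thesis by eventually_elim simp
qed

text \<open>A factor that depends on \<open>X\<close> only moves in and out of the conditional
  expectation; its boundedness makes the product with \<open>Z\<close> integrable.\<close>

lemma (in prob_space) integral_mult_cond_mean:
  assumes X: "X \<in> borel_measurable M" and Z: "integrable M Z"
    and f: "f \<in> borel_measurable (sigma_gen M X)" and bdd: "AE \<omega> in M. \<bar>f \<omega>\<bar> \<le> K"
  shows "(\<integral>\<omega>. f \<omega> * cond_mean M X Z \<omega> \<partial>M) = (\<integral>\<omega>. f \<omega> * Z \<omega> \<partial>M)"
    and "integrable M (\<lambda>\<omega>. f \<omega> * cond_mean M X Z \<omega>)"
proof -
  interpret G: finite_measure_subalgebra M "sigma_gen M X"
    by (rule finite_measure_subalgebra_sigma_gen[OF X])
  have "integrable M (\<lambda>\<omega>. f \<omega> * Z \<omega>)"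
    by (rule integrable_mult_bounded_AE[OF Z measurable_from_subalg[OF subalgebra_sigma_gen[OF X] f] bdd])
  note * = G.real_cond_exp_intg[OF this f borel_measurable_integrable[OF Z]]
  show "(\<integral>\<omega>. f \<omega> * cond_mean M X Z \<omega> \<partial>M) = (\<integral>\<omega>. f \<omega> * Z \<omega> \<partial>M)"
    and "integrable M (\<lambda>\<omega>. f \<omega> * cond_mean M X Z \<omega>)"
    unfolding cond_mean_def using * by auto
qed

text \<open>Conditional independence speaks of events only. It makes the weighted treatment residual
  \<open>h * T - h * e\<close>, with \<open>e\<close> the propensity, integrate to 0 over each event
  that \<open>U\<close> lies in a Borel set. The residual thus has conditional mean 0 given
  \<open>U\<close>, and is orthogonal to the integrable \<open>U\<close> without any approximation
  by simple functions.\<close>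

lemma (in prob_space) integral_treated_eq:
  fixes X :: "'a \<Rightarrow> 'x::topological_space"
  assumes X: "X \<in> borel_measurable M" and T[measurable]: "T \<in> borel_measurable M"
    and T_binary: "\<And>\<omega>. \<omega> \<in> space M \<Longrightarrow> T \<omega> \<in> {0, 1}"
    and U: "integrable M U" and indep: "cond_indep_given M X U T"
    and h: "h \<in> borel_measurable (sigma_gen M X)" and bdd: "AE \<omega> in M. \<bar>h \<omega>\<bar> \<le> K"
  shows "(\<integral>\<omega>. h \<omega> * T \<omega> * U \<omega> \<partial>M) = (\<integral>\<omega>. h \<omega> * propensity M X T \<omega> * cond_mean M X U \<omega> \<partial>M)"
proof -
  have [measurable]: "U \<in> borel_measurable M" using U by auto
  have [measurable]: "h \<in> borel_measurable M"
    by (rule measurable_from_subalg[OF subalgebra_sigma_gen[OF X] h])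
  let ?e = "propensity M X T"
  have e[measurable]: "?e \<in> borel_measurable (sigma_gen M X)"
    unfolding propensity_def cond_probability_def cond_mean_def by simp
  have [measurable]: "?e \<in> borel_measurable M"
    by (rule measurable_from_subalg[OF subalgebra_sigma_gen[OF X] e])
  have he: "(\<lambda>\<omega>. h \<omega> * ?e \<omega>) \<in> borel_measurable (sigma_gen M X)" using h e by simp
  have he_bdd: "AE \<omega> in M. \<bar>h \<omega> * ?e \<omega>\<bar> \<le> K"
    by (rule AE_abs_mult_le[OF bdd AE_abs_propensity_le_1[OF X T]])
  have hT_bdd: "AE \<omega> in M. \<bar>h \<omega> * T \<omega>\<bar> \<le> K"
    by (rule AE_abs_mult_le[OF bdd]) (rule AE_I2, drule T_binary, auto)
  let ?D = "\<lambda>\<omega>. h \<omega> * T \<omega> - h \<omega> * ?e \<omega>"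
  have ind_int: "integrable M (indicator S :: 'a \<Rightarrow> real)" if "S \<in> sets M" for S
    using that by (simp add: integrable_indicator_iff emeasure_eq_measure)
  \<comment> \<open>Bounded functions are integrable on a probability space: the integrable factor
    is taken to be the constant 1.\<close>
  have 1: "integrable M (\<lambda>\<omega>. h \<omega> * T \<omega>)" "integrable M (\<lambda>\<omega>. h \<omega> * ?e \<omega>)"
    using integrable_mult_bounded_AE[of M "\<lambda>_. 1", OF _ _ hT_bdd]
      integrable_mult_bounded_AE[of M "\<lambda>_. 1", OF _ _ he_bdd] by auto
  have 2: "integrable M (\<lambda>\<omega>. h \<omega> * T \<omega> * U \<omega>)" "integrable M (\<lambda>\<omega>. h \<omega> * ?e \<omega> * U \<omega>)"
    by (rule integrable_mult_bounded_AE[OF U _ hT_bdd] integrable_mult_bounded_AE[OF U _ he_bdd]; simp)+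
  have comm: "V * ?D \<omega> = ?D \<omega> * V" for V \<omega> by (rule mult.commute)
  have "(\<integral>\<omega>. U \<omega> * ?D \<omega> \<partial>M) = 0"
  proof (rule integral_mult_eq_0_of_set_integrals)
    fix A :: "real set" assume A[measurable]: "A \<in> sets borel"
    let ?UA = "{\<omega> \<in> space M. U \<omega> \<in> A}" and ?UAT = "{\<omega> \<in> space M. U \<omega> \<in> A \<and> T \<omega> \<in> {1}}"
    have S[measurable]: "?UA \<in> sets M" "?UAT \<in> sets M" by measurable
    \<comment> \<open>The Borel set for \<open>T\<close> is \<open>{1}\<close>, whose conditional
      probability is the propensity.\<close>
    have "AE \<omega> in M. cond_probability M X ?UAT \<omega> = cond_probability M X ?UA \<omega> * ?e \<omega>"
      using indep[unfolded cond_indep_given_def, rule_format, OF A, of "{1}"] by (simp add: propensity_def)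
    then have "(\<integral>\<omega>. h \<omega> * cond_probability M X ?UAT \<omega> \<partial>M)
        = (\<integral>\<omega>. h \<omega> * ?e \<omega> * cond_probability M X ?UA \<omega> \<partial>M)"
      by (intro integral_cong_AE) (auto simp: cond_probability_def cond_mean_def)
    \<comment> \<open>Both weights, \<open>h\<close> and \<open>h * ?e\<close>, are bounded and
      depend on \<open>X\<close> only, so each conditional probability may be replaced by its
      indicator.\<close>
    then have "(\<integral>\<omega>. h \<omega> * indicator ?UAT \<omega> \<partial>M) = (\<integral>\<omega>. h \<omega> * ?e \<omega> * indicator ?UA \<omega> \<partial>M)"
      unfolding cond_probability_def
        integral_mult_cond_mean(1)[OF X ind_int[OF S(1)] he he_bdd]
        integral_mult_cond_mean(1)[OF X ind_int[OF S(2)] h bdd] .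
    \<comment> \<open>Since \<open>T\<close> is 0 or 1, it is itself the indicator of
      \<open>T = 1\<close>.\<close>
    moreover have "(\<integral>\<omega>. h \<omega> * indicator ?UAT \<omega> \<partial>M) = (\<integral>\<omega>. h \<omega> * T \<omega> * indicator ?UA \<omega> \<partial>M)"
      using T_binary by (intro Bochner_Integration.integral_cong) (auto simp: indicator_def)
    moreover have "integrable M (\<lambda>\<omega>. h \<omega> * T \<omega> * indicator ?UA \<omega>)"
        "integrable M (\<lambda>\<omega>. h \<omega> * ?e \<omega> * indicator ?UA \<omega>)"
      by (rule integrable_mult_bounded_AE[OF ind_int _ hT_bdd] integrable_mult_bounded_AE[OF ind_int _ he_bdd]; simp)+
    ultimately have "(\<integral>\<omega>. h \<omega> * T \<omega> * indicator ?UA \<omega> - h \<omega> * ?e \<omega> * indicator ?UA \<omega> \<partial>M) = 0"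
      by (simp only: Bochner_Integration.integral_diff right_minus_eq)
    then show "(\<integral>\<omega>. indicator ?UA \<omega> * ?D \<omega> \<partial>M) = 0"
      by (simp only: comm left_diff_distrib)
  next
    show "integrable M (\<lambda>\<omega>. U \<omega> * ?D \<omega>)"
      unfolding comm left_diff_distrib by (rule Bochner_Integration.integrable_diff[OF 2])
  qed (use 1 in simp_all)
  then have "(\<integral>\<omega>. h \<omega> * T \<omega> * U \<omega> \<partial>M) = (\<integral>\<omega>. h \<omega> * ?e \<omega> * U \<omega> \<partial>M)"
    unfolding comm left_diff_distrib Bochner_Integration.integral_diff[OF 2] by simp
  \<comment> \<open>The weight \<open>h * ?e\<close> depends on \<open>X\<close> only, so
    \<open>U\<close> may be exchanged for its conditional mean.\<close>
  then show ?thesis by (simp add: integral_mult_cond_mean(1)[OF X U he he_bdd])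
qed

section \<open>Convergence in probability of differences\<close>

lemma (in prob_space) conv_in_prob_diff:
  fixes Z W :: "nat \<Rightarrow> 'a \<Rightarrow> real"
  assumes Z: "conv_in_prob M Z a" and W: "conv_in_prob M W b"
  shows "conv_in_prob M (\<lambda>n \<omega>. Z n \<omega> - W n \<omega>) (a - b)"
  unfolding conv_in_prob_def
proof (intro conjI allI impI)
  have [measurable]: "Z n \<in> borel_measurable M" "W n \<in> borel_measurable M" for n
    using Z W by (auto simp: conv_in_prob_def)
  show "(\<lambda>\<omega>. Z n \<omega> - W n \<omega>) \<in> borel_measurable M" for n by measurable
  fix \<epsilon> :: real assume "\<epsilon> > 0"
  let ?P = "\<lambda>Z c n. measure M {\<omega> \<in> space M. dist (Z n \<omega>) c > \<epsilon> / 2}"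
  show "(\<lambda>n. measure M {\<omega> \<in> space M. dist (Z n \<omega> - W n \<omega>) (a - b) > \<epsilon>}) \<longlonglongrightarrow> 0"
  proof (rule tendsto_sandwich[where f = "\<lambda>_. 0"])
    show "(\<lambda>n. ?P Z a n + ?P W b n) \<longlonglongrightarrow> 0"
      using Z W half_gt_zero[OF \<open>\<epsilon> > 0\<close>] unfolding conv_in_prob_def
      by (intro tendsto_add_zero) blast+
    show "\<forall>\<^sub>F n in sequentially. measure M {\<omega> \<in> space M. dist (Z n \<omega> - W n \<omega>) (a - b) > \<epsilon>}
        \<le> ?P Z a n + ?P W b n"
    proof (intro always_eventually allI)
      fix n
      \<comment> \<open>By the triangle inequality, a deviation above \<epsilon> forces one of the
        two sequences to deviate by more than \<epsilon>/2; the union bound then applies.\<close>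
      have "measure M {\<omega> \<in> space M. dist (Z n \<omega> - W n \<omega>) (a - b) > \<epsilon>} \<le>
        measure M ({\<omega> \<in> space M. dist (Z n \<omega>) a > \<epsilon> / 2} \<union> {\<omega> \<in> space M. dist (W n \<omega>) b > \<epsilon> / 2})"
        by (rule finite_measure_mono) (auto simp: dist_real_def, smt (verit))
      also have "\<dots> \<le> ?P Z a n + ?P W b n"
        by (rule measure_Un_le) measurable
      finally show "measure M {\<omega> \<in> space M. dist (Z n \<omega> - W n \<omega>) (a - b) > \<epsilon>} \<le> ?P Z a n + ?P W b n" .
    qed
  qed auto
qed

lemma conv_in_prob_const: "conv_in_prob M (\<lambda>_ _. c) c"
  by (simp add: conv_in_prob_def)

section \<open>Inverse weighting of outcome residuals\<close>

text \<open>The summands and the limit in terms of inverse weighting, with \<open>p\<close> for \<open>e\<^sup>*\<close>.\<close>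

lemma inverse_weighting_identities:
  fixes p :: real
  assumes "0 < p" "p < 1"
  shows "(t * y - (t - p) * m) / p = 1 / p * t * (y - m) + m"
    and "((1 - t) * y + (t - p) * m) / (1 - p) = 1 / (1 - p) * (y - m) - 1 / (1 - p) * t * (y - m) + m"
    and "(f - p) * (u - m) / p = 1 / p * f * (u - m) - (u - m)"
    and "(f - p) * (u - m) / (1 - p)
      = (u - m) - (1 / (1 - p) * (u - m) - 1 / (1 - p) * f * (u - m))"
proof -
  \<comment> \<open>In the control identities the denominator becomes the single variable
    \<open>q\<close>, so that the simplifier can cancel it as it cancels \<open>p\<close> in the
    treated ones.\<close>
  define q where "q = 1 - p"
  have p: "p = 1 - q" and nz: "p \<noteq> 0" "q \<noteq> 0" using assms by (auto simp: q_def)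
  show "(t * y - (t - p) * m) / p = 1 / p * t * (y - m) + m"
    and "(f - p) * (u - m) / p = 1 / p * f * (u - m) - (u - m)"
    using nz(1) by (simp_all add: add_divide_distrib diff_divide_distrib algebra_simps)
  show "((1 - t) * y + (t - p) * m) / (1 - p) = 1 / (1 - p) * (y - m) - 1 / (1 - p) * t * (y - m) + m"
    and "(f - p) * (u - m) / (1 - p)
      = (u - m) - (1 / (1 - p) * (u - m) - 1 / (1 - p) * f * (u - m))"
    unfolding p using nz(2) by (simp_all add: add_divide_distrib diff_divide_distrib algebra_simps)
qed

text \<open>The residual is split into \<open>U\<close> and \<open>m\<close>. The \<open>U\<close>
  part is \<open>integral_treated_eq\<close>; the \<open>m\<close> part comes from pulling
  \<open>h * m\<close> out of the conditional expectation of the indicator of \<open>T = 1\<close>.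
  The integrability claims allow the means of the summands to be split later.\<close>

lemma (in prob_space) integral_treated_residual:
  fixes X :: "'a \<Rightarrow> 'x::topological_space"
  assumes X: "X \<in> borel_measurable M" and T[measurable]: "T \<in> borel_measurable M"
    and T_binary: "\<And>\<omega>. \<omega> \<in> space M \<Longrightarrow> T \<omega> \<in> {0, 1}"
    and U: "integrable M U" and indep: "cond_indep_given M X U T"
    and h: "h \<in> borel_measurable (sigma_gen M X)" and bdd: "AE \<omega> in M. \<bar>h \<omega>\<bar> \<le> K"
    and m: "m \<in> borel_measurable (sigma_gen M X)" "integrable M m"
  shows "(\<integral>\<omega>. h \<omega> * T \<omega> * (U \<omega> - m \<omega>) \<partial>M)
      = (\<integral>\<omega>. h \<omega> * propensity M X T \<omega> * (cond_mean M X U \<omega> - m \<omega>) \<partial>M)" (is ?treated)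
    and "(\<integral>\<omega>. h \<omega> * (U \<omega> - m \<omega>) \<partial>M) = (\<integral>\<omega>. h \<omega> * (cond_mean M X U \<omega> - m \<omega>) \<partial>M)" (is ?all)
    and "integrable M (\<lambda>\<omega>. h \<omega> * T \<omega> * (U \<omega> - m \<omega>))" (is ?int1)
    and "integrable M (\<lambda>\<omega>. h \<omega> * propensity M X T \<omega> * (cond_mean M X U \<omega> - m \<omega>))" (is ?int2)
    and "integrable M (\<lambda>\<omega>. h \<omega> * (U \<omega> - m \<omega>))" (is ?int3)
    and "integrable M (\<lambda>\<omega>. h \<omega> * (cond_mean M X U \<omega> - m \<omega>))" (is ?int4)
proof -
  let ?e = "propensity M X T" and ?E = "{\<omega> \<in> space M. T \<omega> = 1}"
  interpret G: finite_measure_subalgebra M "sigma_gen M X"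
    by (rule finite_measure_subalgebra_sigma_gen[OF X])
  have [measurable]: "h \<in> borel_measurable M" "?e \<in> borel_measurable M"
    by (rule measurable_from_subalg[OF subalgebra_sigma_gen[OF X]];
        simp add: h propensity_def cond_probability_def cond_mean_def)+
  have hT_bdd: "AE \<omega> in M. \<bar>h \<omega> * T \<omega>\<bar> \<le> K"
    by (rule AE_abs_mult_le[OF bdd]) (rule AE_I2, drule T_binary, auto)
  have he_bdd: "AE \<omega> in M. \<bar>h \<omega> * ?e \<omega>\<bar> \<le> K"
    by (rule AE_abs_mult_le[OF bdd AE_abs_propensity_le_1[OF X T]])
  have cU: "integrable M (cond_mean M X U)"
    unfolding cond_mean_def by (rule G.real_cond_exp_int(1)[OF U])
  have int: "integrable M (\<lambda>\<omega>. h \<omega> * T \<omega> * V \<omega>)" "integrable M (\<lambda>\<omega>. h \<omega> * ?e \<omega> * V \<omega>)"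
      "integrable M (\<lambda>\<omega>. h \<omega> * V \<omega>)" if "integrable M V" for V
    by (rule integrable_mult_bounded_AE[OF that _ hT_bdd] integrable_mult_bounded_AE[OF that _ he_bdd]
        integrable_mult_bounded_AE[OF that _ bdd]; simp)+
  have *: "h \<omega> * m \<omega> * indicator ?E \<omega> = h \<omega> * T \<omega> * m \<omega>" if "\<omega> \<in> space M" for \<omega>
    using T_binary[OF that] that by (auto simp: indicator_def)
  have hm: "(\<lambda>\<omega>. h \<omega> * m \<omega>) \<in> borel_measurable (sigma_gen M X)" using h m by simp
  \<comment> \<open>The factor \<open>h * m\<close> may be unbounded, so
    \<open>integral_mult_cond_mean\<close> does not cover it; the general rule asks only for this
    integrability.\<close>
  have "integrable M (\<lambda>\<omega>. h \<omega> * m \<omega> * indicator ?E \<omega>)"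
    using int(1)[OF m(2)] by (subst Bochner_Integration.integrable_cong[OF refl *]) auto
  then have "(\<integral>\<omega>. h \<omega> * m \<omega> * ?e \<omega> \<partial>M) = (\<integral>\<omega>. h \<omega> * m \<omega> * indicator ?E \<omega> \<partial>M)"
    unfolding propensity_def cond_probability_def cond_mean_def
    by (rule G.real_cond_exp_intg(2)[OF _ hm]) measurable
  also have "\<dots> = (\<integral>\<omega>. h \<omega> * T \<omega> * m \<omega> \<partial>M)"
    by (rule Bochner_Integration.integral_cong[OF refl *])
  finally have "(\<integral>\<omega>. h \<omega> * T \<omega> * m \<omega> \<partial>M) = (\<integral>\<omega>. h \<omega> * ?e \<omega> * m \<omega> \<partial>M)"
    by (simp add: ac_simps)
  then show ?treated
    using integral_treated_eq[OF X T T_binary U indep h bdd]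
    by (simp only: right_diff_distrib Bochner_Integration.integral_diff int U m cU)
  show ?all
    by (simp only: right_diff_distrib Bochner_Integration.integral_diff int U m cU
        integral_mult_cond_mean(1)[OF X U h bdd])
  show ?int1 ?int2 ?int3 ?int4
    by (intro int Bochner_Integration.integrable_diff U m cU)+
qed

section \<open>The limit of the doubly robust estimator\<close>

theorem theorem10:
  fixes M :: "'a measure"
    and X :: "'a \<Rightarrow> 'x::euclidean_space" and T Y Y0 Y1 :: "'a \<Rightarrow> real"
    and Xs :: "nat \<Rightarrow> 'a \<Rightarrow> 'x" and Ts Ys :: "nat \<Rightarrow> 'a \<Rightarrow> real"
    and B :: "'b::euclidean_space set" and A1 :: "'c::euclidean_space set"
    and A0 :: "'d::euclidean_space set"
    and e_mis :: "'x \<Rightarrow> 'b \<Rightarrow> real"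
    and m1_mis :: "'x \<Rightarrow> 'c \<Rightarrow> real" and m0_mis :: "'x \<Rightarrow> 'd \<Rightarrow> real"
    and \<beta>s :: 'b and \<alpha>1s :: 'c and \<alpha>0s :: 'd
    and \<beta>_est :: "nat \<Rightarrow> (nat \<Rightarrow> real \<times> 'x \<times> real) \<Rightarrow> 'b"
    and \<alpha>1_est :: "nat \<Rightarrow> (nat \<Rightarrow> real \<times> 'x \<times> real) \<Rightarrow> 'c"
    and \<alpha>0_est :: "nat \<Rightarrow> (nat \<Rightarrow> real \<times> 'x \<times> real) \<Rightarrow> 'd"
    and \<eta> \<nu> :: real
  defines "e \<equiv> propensity M X T"
    and "\<mu>1 \<equiv> cond_mean M X Y1" and "\<mu>0 \<equiv> cond_mean M X Y0"
    and "\<Delta> \<equiv> (\<integral>\<omega>. Y1 \<omega> \<partial>M) - (\<integral>\<omega>. Y0 \<omega> \<partial>M)"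
    and "es \<equiv> \<lambda>\<omega>. e_mis (X \<omega>) \<beta>s"
    and "\<mu>1s \<equiv> \<lambda>\<omega>. m1_mis (X \<omega>) \<alpha>1s" and "\<mu>0s \<equiv> \<lambda>\<omega>. m0_mis (X \<omega>) \<alpha>0s"
    and "\<beta>h \<equiv> \<lambda>n \<omega>. \<beta>_est n (sample Ts Xs Ys n \<omega>)"
    and "\<alpha>1h \<equiv> \<lambda>n \<omega>. \<alpha>1_est n (sample Ts Xs Ys n \<omega>)"
    and "\<alpha>0h \<equiv> \<lambda>n \<omega>. \<alpha>0_est n (sample Ts Xs Ys n \<omega>)"
  assumes prob: "prob_space M"
    and X_rv: "X \<in> borel_measurable M"
    and T_rv: "T \<in> borel_measurable M" and T_binary: "\<And>\<omega>. \<omega> \<in> space M \<Longrightarrow> T \<omega> \<in> {0, 1}"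
    and Y1_int: "integrable M Y1" and Y0_int: "integrable M Y0"
    and Y_eq: "\<And>\<omega>. \<omega> \<in> space M \<Longrightarrow> Y \<omega> = T \<omega> * Y1 \<omega> + (1 - T \<omega>) * Y0 \<omega>"
    and iid: "iid_copies M (\<lambda>i \<omega>. (Ts i \<omega>, Xs i \<omega>, Ys i \<omega>)) (\<lambda>\<omega>. (T \<omega>, X \<omega>, Y \<omega>))"
    and e_mis_range: "\<And>x \<beta>. \<beta> \<in> B \<Longrightarrow> 0 < e_mis x \<beta> \<and> e_mis x \<beta> < 1"
    and e_mis_meas: "\<And>\<beta>. \<beta> \<in> B \<Longrightarrow> (\<lambda>x. e_mis x \<beta>) \<in> borel_measurable borel"
    and m1_mis_meas: "\<And>\<alpha>. \<alpha> \<in> A1 \<Longrightarrow> (\<lambda>x. m1_mis x \<alpha>) \<in> borel_measurable borel"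
    and m0_mis_meas: "\<And>\<alpha>. \<alpha> \<in> A0 \<Longrightarrow> (\<lambda>x. m0_mis x \<alpha>) \<in> borel_measurable borel"
    and params: "\<beta>s \<in> B" "\<alpha>1s \<in> A1" "\<alpha>0s \<in> A0"
    and estimators: "estimator_seq B \<beta>_est" "estimator_seq A1 \<alpha>1_est" "estimator_seq A0 \<alpha>0_est"
    and \<mu>s_int: "integrable M \<mu>1s" "integrable M \<mu>0s"
    and i: "cond_indep_given M X Y1 T" "cond_indep_given M X Y0 T"
    and ii: "\<eta> > 0" "AE \<omega> in M. \<eta> < e \<omega> \<and> e \<omega> < 1 - \<eta>"
    and iii: "conv_in_prob M \<beta>h \<beta>s"
    and iv: "\<nu> > 0" "AE \<omega> in M. \<nu> < es \<omega> \<and> es \<omega> < 1 - \<nu>"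
    and v: "conv_in_prob M \<alpha>1h \<alpha>1s" "conv_in_prob M \<alpha>0h \<alpha>0s"
    and vi:
      "conv_in_prob M
         (\<lambda>n \<omega>. 1 / real n *
            (\<Sum>i=1..n. dr_term1 e_mis m1_mis (Ts i \<omega>) (Xs i \<omega>) (Ys i \<omega>) (\<beta>h n \<omega>) (\<alpha>1h n \<omega>)))
         (\<integral>\<omega>. dr_term1 e_mis m1_mis (T \<omega>) (X \<omega>) (Y \<omega>) \<beta>s \<alpha>1s \<partial>M)"
      "conv_in_prob M
         (\<lambda>n \<omega>. 1 / real n *
            (\<Sum>i=1..n. dr_term0 e_mis m0_mis (Ts i \<omega>) (Xs i \<omega>) (Ys i \<omega>) (\<beta>h n \<omega>) (\<alpha>0h n \<omega>)))
         (\<integral>\<omega>. dr_term0 e_mis m0_mis (T \<omega>) (X \<omega>) (Y \<omega>) \<beta>s \<alpha>0s \<partial>M)"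
  shows "conv_in_prob M
     (\<lambda>n \<omega>. dr_estimator e_mis m1_mis m0_mis Ts Xs Ys \<beta>h \<alpha>1h \<alpha>0h n \<omega> - \<Delta>)
     ((\<integral>\<omega>. (e \<omega> - es \<omega>) * (\<mu>1 \<omega> - \<mu>1s \<omega>) / es \<omega> \<partial>M)
      + (\<integral>\<omega>. (e \<omega> - es \<omega>) * (\<mu>0 \<omega> - \<mu>0s \<omega>) / (1 - es \<omega>) \<partial>M))"
proof -
  interpret prob_space M by (rule prob)
  interpret G: finite_measure_subalgebra M "sigma_gen M X"
    by (rule finite_measure_subalgebra_sigma_gen[OF X_rv])
  have es: "es \<in> borel_measurable (sigma_gen M X)"
    unfolding es_def by (rule measurable_sigma_gen_comp[OF e_mis_meas[OF params(1)]])
  have es_eq: "e_mis (X \<omega>) \<beta>s = es \<omega>" and \<mu>1s_eq: "m1_mis (X \<omega>) \<alpha>1s = \<mu>1s \<omega>"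
    and \<mu>0s_eq: "m0_mis (X \<omega>) \<alpha>0s = \<mu>0s \<omega>" for \<omega>
    by (simp_all add: es_def \<mu>1s_def \<mu>0s_def)
  \<comment> \<open>The range of the working model gives these bounds at every point, so the
    identities can rewrite integrands without exceptional null sets.\<close>
  have "0 < es \<omega>" "es \<omega> < 1" for \<omega>
    using e_mis_range[OF params(1)] by (auto simp: es_def)
  note identities = inverse_weighting_identities[OF this]
  have \<mu>s: "\<mu>1s \<in> borel_measurable (sigma_gen M X)" "\<mu>0s \<in> borel_measurable (sigma_gen M X)"
    unfolding \<mu>1s_def \<mu>0s_def
    by (rule measurable_sigma_gen_comp[OF m1_mis_meas[OF params(2)]]
        measurable_sigma_gen_comp[OF m0_mis_meas[OF params(3)]])+
  have \<mu>: "integrable M \<mu>1" "integrable M \<mu>0" "integral\<^sup>L M \<mu>1 = integral\<^sup>L M Y1" "integral\<^sup>L M \<mu>0 = integral\<^sup>L M Y0"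
    unfolding \<mu>1_def \<mu>0_def cond_mean_def by (auto intro: G.real_cond_exp_int Y1_int Y0_int)
  have h: "(\<lambda>\<omega>. 1 / es \<omega>) \<in> borel_measurable (sigma_gen M X)"
      "(\<lambda>\<omega>. 1 / (1 - es \<omega>)) \<in> borel_measurable (sigma_gen M X)"
    using es by simp_all
  \<comment> \<open>By (iv) both \<open>es\<close> and \<open>1 - es\<close> exceed \<nu> almost
    surely.\<close>
  have h_bdd: "AE \<omega> in M. \<bar>1 / es \<omega>\<bar> \<le> 1 / \<nu>" "AE \<omega> in M. \<bar>1 / (1 - es \<omega>)\<bar> \<le> 1 / \<nu>"
    by (rule eventually_mono[OF iv(2)], use iv(1) in \<open>simp add: frac_le\<close>)+
  note r1 = integral_treated_residual[OF X_rv T_rv T_binary Y1_int i(1) h(1) h_bdd(1) \<mu>s(1) \<mu>s_int(1),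
      folded e_def \<mu>1_def]
  note r0 = integral_treated_residual[OF X_rv T_rv T_binary Y0_int i(2) h(2) h_bdd(2) \<mu>s(2) \<mu>s_int(2),
      folded e_def \<mu>0_def]
  let ?R1 = "\<integral>\<omega>. (e \<omega> - es \<omega>) * (\<mu>1 \<omega> - \<mu>1s \<omega>) / es \<omega> \<partial>M"
  let ?R0 = "\<integral>\<omega>. (e \<omega> - es \<omega>) * (\<mu>0 \<omega> - \<mu>0s \<omega>) / (1 - es \<omega>) \<partial>M"
  let ?L1 = "\<integral>\<omega>. dr_term1 e_mis m1_mis (T \<omega>) (X \<omega>) (Y \<omega>) \<beta>s \<alpha>1s \<partial>M"
  let ?L0 = "\<integral>\<omega>. dr_term0 e_mis m0_mis (T \<omega>) (X \<omega>) (Y \<omega>) \<beta>s \<alpha>0s \<partial>M"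

  \<comment> \<open>As \<open>T\<close> is 0 or 1, the part of \<open>Y\<close> from
    \<open>Y0\<close> vanishes after multiplication by \<open>T\<close>.\<close>
  have "?L1 = (\<integral>\<omega>. 1 / es \<omega> * T \<omega> * (Y1 \<omega> - \<mu>1s \<omega>) + \<mu>1s \<omega> \<partial>M)"
  proof (rule Bochner_Integration.integral_cong[OF refl])
    fix \<omega> assume \<omega>: "\<omega> \<in> space M"
    then have "T \<omega> * Y \<omega> = T \<omega> * Y1 \<omega>" using T_binary[OF \<omega>] Y_eq[OF \<omega>] by auto
    then show "dr_term1 e_mis m1_mis (T \<omega>) (X \<omega>) (Y \<omega>) \<beta>s \<alpha>1s
        = 1 / es \<omega> * T \<omega> * (Y1 \<omega> - \<mu>1s \<omega>) + \<mu>1s \<omega>"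
      by (simp only: dr_term1_def es_eq \<mu>1s_eq identities(1))
  qed
  also have "\<dots> = (\<integral>\<omega>. 1 / es \<omega> * e \<omega> * (\<mu>1 \<omega> - \<mu>1s \<omega>) \<partial>M) + integral\<^sup>L M \<mu>1s"
    using r1(1,3) \<mu>s_int(1) by (simp only: Bochner_Integration.integral_add)
  \<comment> \<open>By the third identity the weighted integral is \<open>?R1\<close> plus the mean
    of \<open>\<mu>1 - \<mu>1s\<close>. The mean of \<open>\<mu>1s\<close> cancels, and
    \<open>\<mu>1\<close> has the mean of \<open>Y1\<close>.\<close>
  also have "\<dots> = ?R1 + integral\<^sup>L M Y1"
    unfolding identities(3) using r1(4) \<mu> \<mu>s_int(1)
    by (simp only: Bochner_Integration.integral_diff Bochner_Integration.integrable_diff)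
  finally have L1: "?L1 = ?R1 + integral\<^sup>L M Y1" .

  \<comment> \<open>The control weight \<open>1 - T\<close> is expanded into the residual over
    everyone minus the residual over the treated, so the results for \<open>T\<close> serve this arm
    too.\<close>
  have "?L0 = (\<integral>\<omega>. 1 / (1 - es \<omega>) * (Y0 \<omega> - \<mu>0s \<omega>)
      - 1 / (1 - es \<omega>) * T \<omega> * (Y0 \<omega> - \<mu>0s \<omega>) + \<mu>0s \<omega> \<partial>M)"
  proof (rule Bochner_Integration.integral_cong[OF refl])
    fix \<omega> assume \<omega>: "\<omega> \<in> space M"
    then have "(1 - T \<omega>) * Y \<omega> = (1 - T \<omega>) * Y0 \<omega>" using T_binary[OF \<omega>] Y_eq[OF \<omega>] by auto
    then show "dr_term0 e_mis m0_mis (T \<omega>) (X \<omega>) (Y \<omega>) \<beta>s \<alpha>0s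
        = 1 / (1 - es \<omega>) * (Y0 \<omega> - \<mu>0s \<omega>) - 1 / (1 - es \<omega>) * T \<omega> * (Y0 \<omega> - \<mu>0s \<omega>) + \<mu>0s \<omega>"
      by (simp only: dr_term0_def es_eq \<mu>0s_eq identities(2))
  qed
  also have "\<dots> = (\<integral>\<omega>. 1 / (1 - es \<omega>) * (\<mu>0 \<omega> - \<mu>0s \<omega>) \<partial>M)
      - (\<integral>\<omega>. 1 / (1 - es \<omega>) * e \<omega> * (\<mu>0 \<omega> - \<mu>0s \<omega>) \<partial>M) + integral\<^sup>L M \<mu>0s"
    using r0(1,2,3,5) \<mu>s_int(2)
    by (simp only: Bochner_Integration.integral_add Bochner_Integration.integral_diff
        Bochner_Integration.integrable_diff)
  \<comment> \<open>By the fourth identity the difference of the two integrals is the mean of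
    \<open>\<mu>0 - \<mu>0s\<close> minus \<open>?R0\<close>; hence the opposite sign compared with
    the treated arm.\<close>
  also have "\<dots> = integral\<^sup>L M Y0 - ?R0"
    unfolding identities(4) using r0(4,6) \<mu> \<mu>s_int(2)
    by (simp only: Bochner_Integration.integral_diff Bochner_Integration.integrable_diff)
  finally have L0: "?L0 = integral\<^sup>L M Y0 - ?R0" .

  \<comment> \<open>Subtracting the control arm turns \<open>- ?R0\<close> into
    \<open>+ ?R0\<close>, and the outcome means cancel against \<Delta>. Centring is then the
    subtraction of a constant sequence.\<close>
  have "?L1 - ?L0 - \<Delta> = ?R1 + ?R0" unfolding L1 L0 \<Delta>_def by simp
  then show ?thesis
    using conv_in_prob_diff[OF conv_in_prob_diff[OF vi] conv_in_prob_const[of M \<Delta>]]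
    by (simp add: dr_estimator_def)
qed

end
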